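(* Let $(M,\varphi,\xi,\eta,g,\varepsilon)$ be an $n$-dimensional $(\varepsilon)$-para Sasakian manifold admitting an $\eta$-Ricci soliton $(g,V,\lambda,\mu)$ whose potential vector field $V$ is pointwise collinear with $\xi$, i.e. $V=k\xi$ for some smooth function $k$ on $M$. If $\varepsilon(n-1)=\lambda+\varepsilon\mu$, then $V$ is a constant multiple of $\xi$ and $M$ is an Einstein-like manifold.
   Context: An $(\varepsilon)$-almost paracontact metric structure $(\varphi,\xi,\eta,g,\varepsilon)$ on an $n$-dimensional manifold $M$ consists of a $(1,1)$-tensor field $\varphi$, a vector field $\xi$, a $1$-form $\eta$, a pseudo-Riemannian metric $g$ and $\varepsilon\in\{1,-1\}$ with $\varphi^2=I-\eta\otimes\xi$, $\eta(\xi)=1$, $\varphi\xi=0$, $\eta\circ\varphi=0$ and $g(\varphi X,\varphi Y)=g(X,Y)-\varepsilon\eta(X)\eta(Y)$ for all vector fields $X,Y$. (Consequently $g(X,\xi)=\varepsilon\eta(X)$ and $g(\varphi X,Y)=g(X,\varphi Y)$.) It is $(\varepsilon)$-para Sasakian if $(\nabla_X\varphi)Y=-g(\varphi X,\varphi Y)\xi-\varepsilon\eta(Y)\varphi^2X$ for all $X,Y$, where $\nabla$ is the Levi-Civita connection of $g$; in that case one has $\nabla_X\xi=\varepsilon\varphi X$. Conventions: $R(X,Y)Z=\nabla_X\nabla_YZ-\nabla_Y\nabla_XZ-\nabla_{[X,Y]}Z$, and the Ricci tensor is $S(Y,Z)=\mathrm{trace}(X\mapsto R(X,Y)Z)$.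 An $\eta$-Ricci soliton is a tuple $(g,V,\lambda,\mu)$, with $V$ a smooth vector field (the potential vector field) and $\lambda,\mu$ real constants, such that $\frac12\mathcal{L}_Vg+S+\lambda g+\mu\,\eta\otimes\eta=0$. $M$ is Einstein-like if there are real constants $a,b,c$ with $S(X,Y)=a\,g(X,Y)+b\,g(\varphi X,Y)+c\,\eta(X)\eta(Y)$ for all vector fields $X,Y$.
   Formalization: The manifold M is assumed connected; on a disconnected M the function k need only be locally constant, so V need not be a constant multiple of ξ (e.g. two disjoint lines with n = 1, λ = μ = 0 and different constants k). *)

theory Defs
  imports "HOL-Analysis.Analysis"
begin

section \<open>Smooth maps between Euclidean spaces\<close>

text \<open>Only meant for open sets \<open>S\<close> of a finite-dimensional space, where differentiability together
  with \<open>C\<^sup>k\<close> regularity of all directional derivatives amounts to \<open>C\<^bsup>k+1\<^esup>\<close> regularity.\<close>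

primrec Ck_on :: "nat \<Rightarrow> 'a::euclidean_space set \<Rightarrow> ('a \<Rightarrow> 'b::euclidean_space) \<Rightarrow> bool" where
  "Ck_on 0 S f \<longleftrightarrow> continuous_on S f"
| "Ck_on (Suc k) S f \<longleftrightarrow>
     f differentiable_on S \<and> (\<forall>v. Ck_on k S (\<lambda>x. frechet_derivative f (at x) v))"

definition smooth_on :: "'a::euclidean_space set \<Rightarrow> ('a \<Rightarrow> 'b::euclidean_space) \<Rightarrow> bool" where
  "smooth_on S f \<longleftrightarrow> (\<forall>k. Ck_on k S f)"

section \<open>Smooth manifolds\<close>

text \<open>The manifold is a whole type \<open>'m\<close>, of class \<open>t2_space\<close> and \<open>second_countable_topology\<close>,
  with an atlas. A chart is its domain together with its coordinate map, whose values outside the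
  domain are irrelevant.\<close>

type_synonym ('m, 'e) chart = "'m set \<times> ('m \<Rightarrow> 'e)"

abbreviation chart_dom :: "('m, 'e) chart \<Rightarrow> 'm set" where
  "chart_dom c \<equiv> fst c"

abbreviation chart_im :: "('m, 'e) chart \<Rightarrow> 'e set" where
  "chart_im c \<equiv> snd c ` fst c"

definition chart_inv :: "('m, 'e) chart \<Rightarrow> 'e \<Rightarrow> 'm" where
  "chart_inv c = inv_into (fst c) (snd c)"

definition smooth_atlas ::
    "('m::{t2_space, second_countable_topology}, real^'n) chart set \<Rightarrow> bool" where
  "smooth_atlas A \<longleftrightarrow>
     (\<Union>c\<in>A. chart_dom c) = UNIV \<and>
     (\<forall>c\<in>A. open (chart_dom c) \<and> open (chart_im c) \<and>
        homeomorphism (chart_dom c) (chart_im c) (snd c) (chart_inv c)) \<and>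
     (\<forall>c\<in>A. \<forall>d\<in>A. smooth_on (snd c ` (chart_dom c \<inter> chart_dom d)) (snd d \<circ> chart_inv c))"

text \<open>One chart of the atlas is chosen around every point \<open>p\<close>, and the tangent space at \<open>p\<close> is
  \<open>real^'n\<close>, a tangent vector being given by its components in the chosen chart. Accordingly a
  vector field is a function \<open>'m \<Rightarrow> real^'n\<close>, a covector field a function \<open>'m \<Rightarrow> real^'n \<Rightarrow> real\<close>, etc.;
  the chosen chart may jump from point to point, so smoothness of a vector field is
  \<^emph>\<open>not\<close> smoothness of this function, but is tested in the charts of the atlas (see
  \<open>vector_field\<close>).\<close>

definition chart_at :: "('m, real^'n) chart set \<Rightarrow> 'm \<Rightarrow> ('m, real^'n) chart" where
  "chart_at A p = (SOME c. c \<in> A \<and> p \<in> chart_dom c)"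

definition smooth_fun :: "('m, real^'n) chart set \<Rightarrow> ('m \<Rightarrow> real) \<Rightarrow> bool" where
  "smooth_fun A f \<longleftrightarrow> (\<forall>c\<in>A. smooth_on (chart_im c) (f \<circ> chart_inv c))"

text \<open>The differential of \<open>f\<close> at \<open>p\<close>, on the tangent space at \<open>p\<close>. If \<open>f\<close> is the coordinate map of
  a chart around \<open>p\<close>, it sends a tangent vector to its components in that chart.\<close>

definition mdiff ::
    "('m, real^'n) chart set \<Rightarrow> ('m \<Rightarrow> 'b::euclidean_space) \<Rightarrow> 'm \<Rightarrow> real^'n \<Rightarrow> 'b" where
  "mdiff A f p v =
     frechet_derivative (f \<circ> chart_inv (chart_at A p)) (at (snd (chart_at A p) p)) v"

definition local_repr ::
    "('m, real^'n) chart set \<Rightarrow> ('m, real^'n) chart \<Rightarrow> ('m \<Rightarrow> real^'n) \<Rightarrow> real^'n \<Rightarrow> real^'n" where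
  "local_repr A c X x = mdiff A (snd c) (chart_inv c x) (X (chart_inv c x))"

definition vector_field :: "('m, real^'n) chart set \<Rightarrow> ('m \<Rightarrow> real^'n) \<Rightarrow> bool" where
  "vector_field A X \<longleftrightarrow> (\<forall>c\<in>A. smooth_on (chart_im c) (local_repr A c X))"

definition deriv_along ::
    "('m, real^'n) chart set \<Rightarrow> ('m \<Rightarrow> real^'n) \<Rightarrow> ('m \<Rightarrow> real) \<Rightarrow> 'm \<Rightarrow> real" where
  "deriv_along A X f p = mdiff A f p (X p)"

text \<open>\<open>[X, Y]\<^sup>i = X\<^sup>j \<partial>\<^sub>j Y\<^sup>i - Y\<^sup>j \<partial>\<^sub>j X\<^sup>i\<close>, so that \<open>[X, Y] f = X (Y f) - Y (X f)\<close>.\<close>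

definition lie_bracket ::
    "('m, real^'n) chart set \<Rightarrow> ('m \<Rightarrow> real^'n) \<Rightarrow> ('m \<Rightarrow> real^'n) \<Rightarrow> 'm \<Rightarrow> real^'n" where
  "lie_bracket A X Y p =
     (let c = chart_at A p; x = snd c p in
        frechet_derivative (local_repr A c Y) (at x) (X p)
        - frechet_derivative (local_repr A c X) (at x) (Y p))"

section \<open>Tensor fields\<close>

text \<open>A tensor field is a family of multilinear maps on the tangent spaces; it is smooth if it
  turns smooth vector fields into smooth objects.\<close>

definition one_form :: "('m, real^'n) chart set \<Rightarrow> ('m \<Rightarrow> real^'n \<Rightarrow> real) \<Rightarrow> bool" where
  "one_form A \<eta> \<longleftrightarrow>
     (\<forall>p. linear (\<eta> p)) \<and> (\<forall>X. vector_field A X \<longrightarrow> smooth_fun A (\<lambda>p. \<eta> p (X p)))"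

definition endo_field :: "('m, real^'n) chart set \<Rightarrow> ('m \<Rightarrow> real^'n \<Rightarrow> real^'n) \<Rightarrow> bool" where
  "endo_field A \<phi> \<longleftrightarrow>
     (\<forall>p. linear (\<phi> p)) \<and> (\<forall>X. vector_field A X \<longrightarrow> vector_field A (\<lambda>p. \<phi> p (X p)))"

definition pseudo_riemannian_metric ::
    "('m, real^'n) chart set \<Rightarrow> ('m \<Rightarrow> real^'n \<Rightarrow> real^'n \<Rightarrow> real) \<Rightarrow> bool" where
  "pseudo_riemannian_metric A g \<longleftrightarrow>
     (\<forall>p. bilinear (g p)) \<and>
     (\<forall>X Y. vector_field A X \<and> vector_field A Y \<longrightarrow> smooth_fun A (\<lambda>p. g p (X p) (Y p))) \<and>
     (\<forall>p v w. g p v w = g p w v) \<and>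
     (\<forall>p v. (\<forall>w. g p v w = 0) \<longrightarrow> v = 0)"

definition lie_deriv_metric ::
    "('m, real^'n) chart set \<Rightarrow> ('m \<Rightarrow> real^'n) \<Rightarrow> ('m \<Rightarrow> real^'n \<Rightarrow> real^'n \<Rightarrow> real)
      \<Rightarrow> ('m \<Rightarrow> real^'n) \<Rightarrow> ('m \<Rightarrow> real^'n) \<Rightarrow> 'm \<Rightarrow> real" where
  "lie_deriv_metric A V g X Y p =
     deriv_along A V (\<lambda>q. g q (X q) (Y q)) p
     - g p (lie_bracket A V X p) (Y p) - g p (X p) (lie_bracket A V Y p)"

section \<open>Levi-Civita connection and curvature\<close>

definition affine_connection ::
    "('m, real^'n) chart set \<Rightarrow> (('m \<Rightarrow> real^'n) \<Rightarrow> ('m \<Rightarrow> real^'n) \<Rightarrow> ('m \<Rightarrow> real^'n)) \<Rightarrow> bool" where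
  "affine_connection A nabla \<longleftrightarrow>
     (\<forall>X Y. vector_field A X \<and> vector_field A Y \<longrightarrow> vector_field A (nabla X Y)) \<and>
     (\<forall>X X' Y. vector_field A X \<and> vector_field A X' \<and> vector_field A Y \<longrightarrow>
        nabla (\<lambda>p. X p + X' p) Y = (\<lambda>p. nabla X Y p + nabla X' Y p)) \<and>
     (\<forall>f X Y. smooth_fun A f \<and> vector_field A X \<and> vector_field A Y \<longrightarrow>
        nabla (\<lambda>p. f p *\<^sub>R X p) Y = (\<lambda>p. f p *\<^sub>R nabla X Y p)) \<and>
     (\<forall>X Y Y'. vector_field A X \<and> vector_field A Y \<and> vector_field A Y' \<longrightarrow>
        nabla X (\<lambda>p. Y p + Y' p) = (\<lambda>p. nabla X Y p + nabla X Y' p)) \<and>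
     (\<forall>f X Y. smooth_fun A f \<and> vector_field A X \<and> vector_field A Y \<longrightarrow>
        nabla X (\<lambda>p. f p *\<^sub>R Y p) = (\<lambda>p. deriv_along A X f p *\<^sub>R Y p + f p *\<^sub>R nabla X Y p))"

definition levi_civita_connection ::
    "('m, real^'n) chart set \<Rightarrow> ('m \<Rightarrow> real^'n \<Rightarrow> real^'n \<Rightarrow> real)
      \<Rightarrow> (('m \<Rightarrow> real^'n) \<Rightarrow> ('m \<Rightarrow> real^'n) \<Rightarrow> ('m \<Rightarrow> real^'n)) \<Rightarrow> bool" where
  "levi_civita_connection A g nabla \<longleftrightarrow>
     affine_connection A nabla \<and>
     (\<forall>X Y p. vector_field A X \<and> vector_field A Y \<longrightarrow>
        nabla X Y p - nabla Y X p = lie_bracket A X Y p) \<and>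
     (\<forall>X Y Z p. vector_field A X \<and> vector_field A Y \<and> vector_field A Z \<longrightarrow>
        deriv_along A X (\<lambda>q. g q (Y q) (Z q)) p
          = g p (nabla X Y p) (Z p) + g p (Y p) (nabla X Z p))"

definition curvature ::
    "('m, real^'n) chart set \<Rightarrow> (('m \<Rightarrow> real^'n) \<Rightarrow> ('m \<Rightarrow> real^'n) \<Rightarrow> ('m \<Rightarrow> real^'n))
      \<Rightarrow> ('m \<Rightarrow> real^'n) \<Rightarrow> ('m \<Rightarrow> real^'n) \<Rightarrow> ('m \<Rightarrow> real^'n) \<Rightarrow> 'm \<Rightarrow> real^'n" where
  "curvature A nabla X Y Z p =
     nabla X (nabla Y Z) p - nabla Y (nabla X Z) p - nabla (lie_bracket A X Y) Z p"

text \<open>The endomorphism \<open>X\<^sub>p \<mapsto> (R(X,Y)Z)\<^sub>p\<close> of the tangent space at \<open>p\<close>. It exists because \<open>R\<close> is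
  tensorial in \<open>X\<close>, and is unique because every tangent vector extends to a vector field.\<close>

definition curvature_endo ::
    "('m, real^'n) chart set \<Rightarrow> (('m \<Rightarrow> real^'n) \<Rightarrow> ('m \<Rightarrow> real^'n) \<Rightarrow> ('m \<Rightarrow> real^'n))
      \<Rightarrow> ('m \<Rightarrow> real^'n) \<Rightarrow> ('m \<Rightarrow> real^'n) \<Rightarrow> 'm \<Rightarrow> real^'n \<Rightarrow> real^'n" where
  "curvature_endo A nabla Y Z p =
     (THE L. linear L \<and> (\<forall>X. vector_field A X \<longrightarrow> L (X p) = curvature A nabla X Y Z p))"

definition ricci ::
    "('m, real^'n) chart set \<Rightarrow> (('m \<Rightarrow> real^'n) \<Rightarrow> ('m \<Rightarrow> real^'n) \<Rightarrow> ('m \<Rightarrow> real^'n))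
      \<Rightarrow> ('m \<Rightarrow> real^'n) \<Rightarrow> ('m \<Rightarrow> real^'n) \<Rightarrow> 'm \<Rightarrow> real" where
  "ricci A nabla Y Z p = trace (matrix (curvature_endo A nabla Y Z p))"

section \<open>Para Sasakian structures and solitons\<close>

definition eps_almost_paracontact_metric ::
    "('m, real^'n) chart set \<Rightarrow> ('m \<Rightarrow> real^'n \<Rightarrow> real^'n) \<Rightarrow> ('m \<Rightarrow> real^'n)
      \<Rightarrow> ('m \<Rightarrow> real^'n \<Rightarrow> real) \<Rightarrow> ('m \<Rightarrow> real^'n \<Rightarrow> real^'n \<Rightarrow> real) \<Rightarrow> real \<Rightarrow> bool" where
  "eps_almost_paracontact_metric A \<phi> \<xi> \<eta> g \<epsilon> \<longleftrightarrow>
     endo_field A \<phi> \<and> vector_field A \<xi> \<and> one_form A \<eta> \<and> pseudo_riemannian_metric A g \<and>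
     \<epsilon> \<in> {1, -1} \<and>
     (\<forall>p v. \<phi> p (\<phi> p v) = v - \<eta> p v *\<^sub>R \<xi> p) \<and>
     (\<forall>p. \<eta> p (\<xi> p) = 1) \<and>
     (\<forall>p. \<phi> p (\<xi> p) = 0) \<and>
     (\<forall>p v. \<eta> p (\<phi> p v) = 0) \<and>
     (\<forall>p v w. g p (\<phi> p v) (\<phi> p w) = g p v w - \<epsilon> * \<eta> p v * \<eta> p w)"

text \<open>The left-hand side is \<open>(\<nabla>\<^sub>X \<phi>) Y = \<nabla>\<^sub>X (\<phi> Y) - \<phi> (\<nabla>\<^sub>X Y)\<close>; \<open>nabla\<close> is meant to be the
  Levi-Civita connection of \<open>g\<close>.\<close>

definition eps_para_sasakian ::
    "('m, real^'n) chart set \<Rightarrow> (('m \<Rightarrow> real^'n) \<Rightarrow> ('m \<Rightarrow> real^'n) \<Rightarrow> ('m \<Rightarrow> real^'n))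
      \<Rightarrow> ('m \<Rightarrow> real^'n \<Rightarrow> real^'n) \<Rightarrow> ('m \<Rightarrow> real^'n)
      \<Rightarrow> ('m \<Rightarrow> real^'n \<Rightarrow> real) \<Rightarrow> ('m \<Rightarrow> real^'n \<Rightarrow> real^'n \<Rightarrow> real) \<Rightarrow> real \<Rightarrow> bool" where
  "eps_para_sasakian A nabla \<phi> \<xi> \<eta> g \<epsilon> \<longleftrightarrow>
     eps_almost_paracontact_metric A \<phi> \<xi> \<eta> g \<epsilon> \<and>
     (\<forall>X Y p. vector_field A X \<and> vector_field A Y \<longrightarrow>
        nabla X (\<lambda>q. \<phi> q (Y q)) p - \<phi> p (nabla X Y p)
          = - g p (\<phi> p (X p)) (\<phi> p (Y p)) *\<^sub>R \<xi> p
            - (\<epsilon> * \<eta> p (Y p)) *\<^sub>R \<phi> p (\<phi> p (X p)))"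

definition eta_ricci_soliton ::
    "('m, real^'n) chart set \<Rightarrow> (('m \<Rightarrow> real^'n) \<Rightarrow> ('m \<Rightarrow> real^'n) \<Rightarrow> ('m \<Rightarrow> real^'n))
      \<Rightarrow> ('m \<Rightarrow> real^'n \<Rightarrow> real) \<Rightarrow> ('m \<Rightarrow> real^'n \<Rightarrow> real^'n \<Rightarrow> real)
      \<Rightarrow> ('m \<Rightarrow> real^'n) \<Rightarrow> real \<Rightarrow> real \<Rightarrow> bool" where
  "eta_ricci_soliton A nabla \<eta> g V lam mu \<longleftrightarrow>
     vector_field A V \<and>
     (\<forall>X Y p. vector_field A X \<and> vector_field A Y \<longrightarrow>
        1 / 2 * lie_deriv_metric A V g X Y p + ricci A nabla X Y p
          + lam * g p (X p) (Y p) + mu * \<eta> p (X p) * \<eta> p (Y p) = 0)"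

definition einstein_like ::
    "('m, real^'n) chart set \<Rightarrow> (('m \<Rightarrow> real^'n) \<Rightarrow> ('m \<Rightarrow> real^'n) \<Rightarrow> ('m \<Rightarrow> real^'n))
      \<Rightarrow> ('m \<Rightarrow> real^'n \<Rightarrow> real^'n) \<Rightarrow> ('m \<Rightarrow> real^'n \<Rightarrow> real)
      \<Rightarrow> ('m \<Rightarrow> real^'n \<Rightarrow> real^'n \<Rightarrow> real) \<Rightarrow> bool" where
  "einstein_like A nabla \<phi> \<eta> g \<longleftrightarrow>
     (\<exists>a b c. \<forall>X Y p. vector_field A X \<and> vector_field A Y \<longrightarrow>
        ricci A nabla X Y p
          = a * g p (X p) (Y p) + b * g p (\<phi> p (X p)) (Y p) + c * \<eta> p (X p) * \<eta> p (Y p))"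

end

theory Submission
  imports Defs "HOL-Real_Asymp.Real_Asymp"
begin

text \<open>Write \<open>V = k \<xi>\<close>. From \<open>\<nabla>\<^sub>X \<xi> = \<epsilon> \<phi> X\<close> and the self-adjointness of \<open>\<phi>\<close> one gets
  \<open>(L\<^sub>V g)(X, Y) = \<epsilon> (X k \<eta>(Y) + Y k \<eta>(X)) + 2 \<epsilon> k g(\<phi> X, Y)\<close>
  (\<open>lie_deriv_metric_collinear\<close>), so the soliton equation already has the shape of the Einstein-like
  condition with coefficient \<open>- \<epsilon> k\<close> of \<open>g(\<phi> X, Y)\<close>, except for the terms in the differential of \<open>k\<close>
  and for \<open>k\<close> being a function. Everything therefore rests on \<open>k\<close> being constant.

  Put \<open>Y = \<xi>\<close> in the soliton equation. The term with \<open>\<phi>\<close> drops out. The para Sasakian identity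
  gives \<open>R(X, Y)\<xi> = \<eta>(X) Y - \<eta>(Y) X\<close> (\<open>curvature_xi\<close>), hence \<open>S(X, \<xi>) = - (n - 1) \<eta>(X)\<close>
  (\<open>ricci_xi\<close>), and what remains is
  \<open>\<epsilon>/2 (X k + (\<xi> k) \<eta>(X)) = (n - 1 - \<epsilon> \<lambda> - \<mu>) \<eta>(X)\<close>. As \<open>\<epsilon>\<^sup>2 = 1\<close>, the assumption on the constants
  says precisely that the right-hand side vanishes. Taking \<open>X = \<xi>\<close> yields \<open>\<xi> k = 0\<close>, and then
  \<open>X k = 0\<close> for every vector field \<open>X\<close> (\<open>deriv_along_potential_eq_0\<close>).

  Two steps need the fact that every tangent vector is the value of a smooth global vector field
  (\<open>vector_field_extension\<close>): the identification of the endomorphism \<open>X \<mapsto> R(X, Y)\<xi>\<close>, whose trace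
  is the Ricci tensor, and the passage from \<open>X k = 0\<close> to the vanishing of the differential of \<open>k\<close>,
  which makes \<open>k\<close> constant on the connected manifold (\<open>zero_differential_imp_constant\<close>). The
  extension multiplies a constant field in a chart by a smooth bump function; its construction
  is what the calculus of \<open>C\<^sup>k\<close> maps below is for.\<close>

section \<open>Calculus of smooth maps\<close>

lemma Ck_on_Suc_derivative:
  assumes "Ck_on (Suc k) S f" "open S" "x \<in> S"
  shows "(f has_derivative frechet_derivative f (at x)) (at x)"
  using assms by (simp add: differentiable_on_eq_differentiable_at frechet_derivative_works[symmetric])

lemma Ck_on_cong:
  assumes "open S" "\<And>x. x \<in> S \<Longrightarrow> f x = g x" "Ck_on k S f"
  shows "Ck_on k S g"
  using assms(2,3)
proof (induction k arbitrary: f g)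
  case 0
  then show ?case by (simp cong: continuous_on_cong)
next
  case (Suc k)
  have der: "(g has_derivative frechet_derivative f (at x)) (at x)" if "x \<in> S" for x
    using Ck_on_Suc_derivative[OF Suc.prems(2) \<open>open S\<close> that] \<open>open S\<close> that Suc.prems(1)
    by (rule has_derivative_transform_within_open)
  have "frechet_derivative f (at x) = frechet_derivative g (at x)" if "x \<in> S" for x
    using frechet_derivative_at[OF der[OF that]] .
  then have "Ck_on k S (\<lambda>x. frechet_derivative g (at x) v)" for v
    using Suc.IH[of "\<lambda>x. frechet_derivative f (at x) v" "\<lambda>x. frechet_derivative g (at x) v"]
      Suc.prems(2) by simp
  moreover have "g differentiable_on S"
    using der \<open>open S\<close> by (auto simp: differentiable_on_eq_differentiable_at differentiable_def)
  ultimately show ?case by simp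
qed

text \<open>Closure under addition, bilinear products and composition is shown by induction on \<open>k\<close>, for
  arbitrary maps: the differentiation rule writes the derivative of the new map through maps that
  are covered by the induction hypothesis. In the induction step one wants to name that expression
  directly instead of \<open>frechet_derivative\<close>, which is what the following rule is for.\<close>

lemma Ck_on_SucI:
  assumes "open S" "\<And>x. x \<in> S \<Longrightarrow> (f has_derivative f' x) (at x)" "\<And>v. Ck_on k S (\<lambda>x. f' x v)"
  shows "Ck_on (Suc k) S f"
proof -
  have "f' x = frechet_derivative f (at x)" if "x \<in> S" for x
    using frechet_derivative_at[OF assms(2)[OF that]] .
  then have "Ck_on k S (\<lambda>x. frechet_derivative f (at x) v)" for v
    using Ck_on_cong[OF \<open>open S\<close> _ assms(3)[of v]] by simp
  moreover have "f differentiable_on S"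
    using assms by (auto simp: differentiable_on_eq_differentiable_at differentiable_def)
  ultimately show ?thesis by simp
qed

lemma Ck_on_subset: "Ck_on k S f \<Longrightarrow> T \<subseteq> S \<Longrightarrow> Ck_on k T f"
  by (induction k arbitrary: f) (auto intro: continuous_on_subset differentiable_on_subset)

lemma Ck_on_Suc_imp: "Ck_on (Suc k) S f \<Longrightarrow> Ck_on k S f"
  by (induction k arbitrary: f) (auto intro: differentiable_imp_continuous_on)

lemma Ck_on_local:
  assumes "\<And>x. x \<in> S \<Longrightarrow> \<exists>U. open U \<and> x \<in> U \<and> Ck_on k U f" "open S"
  shows "Ck_on k S f"
  using assms(1)
proof (induction k arbitrary: f)
  case 0
  then have "continuous (at x) f" if "x \<in> S" for x
    using that continuous_on_eq_continuous_at by fastforce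
  then show ?case by (simp add: continuous_at_imp_continuous_on)
next
  case (Suc k)
  have "f differentiable at x" if "x \<in> S" for x
    using Suc.prems[OF that] by (auto simp: differentiable_on_eq_differentiable_at)
  moreover have "Ck_on k S (\<lambda>x. frechet_derivative f (at x) v)" for v
    using Suc.prems by (intro Suc.IH) fastforce
  ultimately show ?case using \<open>open S\<close> by (simp add: differentiable_on_eq_differentiable_at)
qed

lemma Ck_on_const: "open S \<Longrightarrow> Ck_on k S (\<lambda>x. c)"
proof (induction k arbitrary: c)
  case (Suc k)
  show ?case
    by (rule Ck_on_SucI[OF Suc.prems, where f' = "\<lambda>x v. 0"]) (auto intro: Suc)
qed simp

lemma Ck_on_bounded_linear:
  assumes "bounded_linear f" "open S"
  shows "Ck_on k S f"
proof (cases k)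
  case 0
  then show ?thesis using assms by (simp add: linear_continuous_on)
next
  case (Suc m)
  have "(f has_derivative f) (at x)" for x
    using assms(1) by (rule bounded_linear_imp_has_derivative)
  then show ?thesis
    unfolding Suc by (rule Ck_on_SucI[OF assms(2) _ Ck_on_const[OF assms(2)]])
qed

lemma Ck_on_add:
  assumes "open S" "Ck_on k S f" "Ck_on k S g"
  shows "Ck_on k S (\<lambda>x. f x + g x)"
  using assms(2,3)
proof (induction k arbitrary: f g)
  case 0
  then show ?case by (simp add: continuous_on_add)
next
  case (Suc k)
  show ?case
  proof (rule Ck_on_SucI[OF \<open>open S\<close>])
    show "((\<lambda>x. f x + g x) has_derivative
        (\<lambda>v. frechet_derivative f (at x) v + frechet_derivative g (at x) v)) (at x)"
      if "x \<in> S" for x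
      using Suc.prems that \<open>open S\<close> by (intro has_derivative_add Ck_on_Suc_derivative)
    show "Ck_on k S (\<lambda>x. frechet_derivative f (at x) v + frechet_derivative g (at x) v)" for v
      using Suc.prems by (intro Suc.IH) auto
  qed
qed

lemma Ck_on_sum:
  assumes "open S" "\<And>i. i \<in> I \<Longrightarrow> Ck_on k S (f i)"
  shows "Ck_on k S (\<lambda>x. \<Sum>i\<in>I. f i x)"
  using assms(2)
  by (induction I rule: infinite_finite_induct) (auto intro: Ck_on_const Ck_on_add \<open>open S\<close>)

lemma Ck_on_bilinear:
  fixes prod :: "'a::euclidean_space \<Rightarrow> 'b::euclidean_space \<Rightarrow> 'c::euclidean_space"
  assumes prod: "bounded_bilinear prod" and "open S" "Ck_on k S f" "Ck_on k S g"
  shows "Ck_on k S (\<lambda>x. prod (f x) (g x))"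
  using assms(3,4)
proof (induction k arbitrary: f g)
  case 0
  then show ?case by (simp add: bounded_bilinear.continuous_on[OF prod])
next
  case (Suc k)
  show ?case
  proof (rule Ck_on_SucI[OF \<open>open S\<close>])
    show "((\<lambda>x. prod (f x) (g x)) has_derivative
        (\<lambda>v. prod (f x) (frechet_derivative g (at x) v) + prod (frechet_derivative f (at x) v) (g x)))
        (at x)" if "x \<in> S" for x
      using Suc.prems that \<open>open S\<close> by (intro bounded_bilinear.FDERIV[OF prod] Ck_on_Suc_derivative)
    have "Ck_on k S f" "Ck_on k S g"
      using Suc.prems by (simp_all only: Ck_on_Suc_imp)
    then show "Ck_on k S (\<lambda>x. prod (f x) (frechet_derivative g (at x) v)
        + prod (frechet_derivative f (at x) v) (g x))" for v
      using Suc.prems by (intro Ck_on_add Suc.IH \<open>open S\<close>) auto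
  qed
qed

text \<open>In the derivative \<open>g'(f x)(f' x v)\<close> both the linear map and its argument vary with \<open>x\<close>, whereas
  \<open>Ck_on\<close> speaks about directional derivatives in a fixed direction. Expanding \<open>f' x v\<close> in the
  standard basis turns it into a sum of products to which the induction hypothesis applies.\<close>

lemma Ck_on_compose:
  fixes f :: "'a::euclidean_space \<Rightarrow> 'b::euclidean_space"
    and g :: "'b \<Rightarrow> 'c::euclidean_space"
  assumes "open S" "open T" "f ` S \<subseteq> T" "Ck_on k S f" "Ck_on k T g"
  shows "Ck_on k S (\<lambda>x. g (f x))"
  using assms(4,5)
proof (induction k arbitrary: g)
  case 0
  with assms(3) show ?case by (auto intro: continuous_on_compose2)
next
  case (Suc k)
  let ?f' = "\<lambda>x. frechet_derivative f (at x)" and ?g' = "\<lambda>y. frechet_derivative g (at y)"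
  show ?case
  proof (rule Ck_on_SucI[OF \<open>open S\<close>])
    show "((\<lambda>x. g (f x)) has_derivative (\<lambda>v. \<Sum>b\<in>Basis. (?f' x v \<bullet> b) *\<^sub>R ?g' (f x) b)) (at x)"
      if "x \<in> S" for x
    proof -
      have g': "(g has_derivative ?g' (f x)) (at (f x))"
        using Suc.prems(2) \<open>open T\<close> assms(3) that by (intro Ck_on_Suc_derivative[of k T]) auto
      have "linear (?g' (f x))"
        using g' by (rule has_derivative_linear)
      then have "?g' (f x) (\<Sum>b\<in>Basis. (w \<bullet> b) *\<^sub>R b) = (\<Sum>b\<in>Basis. (w \<bullet> b) *\<^sub>R ?g' (f x) b)" for w
        by (simp only: linear_sum linear_scale)
      then have eq: "(\<lambda>v. ?g' (f x) (?f' x v)) = (\<lambda>v. \<Sum>b\<in>Basis. (?f' x v \<bullet> b) *\<^sub>R ?g' (f x) b)"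
        unfolding euclidean_representation by (rule ext)
      show ?thesis
        using has_derivative_compose[OF Ck_on_Suc_derivative[OF Suc.prems(1) \<open>open S\<close> that] g']
        unfolding eq .
    qed
    show "Ck_on k S (\<lambda>x. \<Sum>b\<in>Basis. (?f' x v \<bullet> b) *\<^sub>R ?g' (f x) b)" for v
    proof (intro Ck_on_sum \<open>open S\<close> Ck_on_bilinear[OF bounded_bilinear_scaleR])
      fix b :: 'b
      show "Ck_on k S (\<lambda>x. ?f' x v \<bullet> b)"
        using Suc.prems by (intro Ck_on_bilinear[OF bounded_bilinear_inner] Ck_on_const \<open>open S\<close>) auto
      show "Ck_on k S (\<lambda>x. ?g' (f x) b)"
        using Suc.prems Ck_on_Suc_imp by (intro Suc.IH) auto
    qed
  qed
qed

lemma smooth_on_derivative: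
  assumes "smooth_on S f" "open S" "x \<in> S"
  shows "(f has_derivative frechet_derivative f (at x)) (at x)"
  using assms Ck_on_Suc_derivative[of 0 S f x] unfolding smooth_on_def by blast

lemma smooth_on_frechet_derivative:
  "smooth_on S f \<Longrightarrow> smooth_on S (\<lambda>x. frechet_derivative f (at x) v)"
  unfolding smooth_on_def using Ck_on.simps(2) by blast

lemma smooth_on_cong:
  "open S \<Longrightarrow> (\<And>x. x \<in> S \<Longrightarrow> f x = g x) \<Longrightarrow> smooth_on S f \<Longrightarrow> smooth_on S g"
  unfolding smooth_on_def using Ck_on_cong by blast

lemma smooth_on_subset: "smooth_on S f \<Longrightarrow> T \<subseteq> S \<Longrightarrow> smooth_on T f"
  unfolding smooth_on_def using Ck_on_subset by blast

lemma smooth_on_local: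
  assumes "\<And>x. x \<in> S \<Longrightarrow> \<exists>U. open U \<and> x \<in> U \<and> smooth_on U f" "open S"
  shows "smooth_on S f"
  using assms unfolding smooth_on_def by (meson Ck_on_local)

lemma smooth_on_const: "open S \<Longrightarrow> smooth_on S (\<lambda>x. c)"
  by (simp add: smooth_on_def Ck_on_const)

lemma smooth_on_add:
  "open S \<Longrightarrow> smooth_on S f \<Longrightarrow> smooth_on S g \<Longrightarrow> smooth_on S (\<lambda>x. f x + g x)"
  by (simp add: smooth_on_def Ck_on_add)

lemma smooth_on_scaleR:
  "open S \<Longrightarrow> smooth_on S f \<Longrightarrow> smooth_on S g \<Longrightarrow> smooth_on S (\<lambda>x. f x *\<^sub>R g x)"
  by (simp add: smooth_on_def Ck_on_bilinear[OF bounded_bilinear_scaleR])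

lemma smooth_on_compose:
  "open S \<Longrightarrow> open T \<Longrightarrow> f ` S \<subseteq> T \<Longrightarrow> smooth_on S f \<Longrightarrow> smooth_on T g \<Longrightarrow>
    smooth_on S (\<lambda>x. g (f x))"
  unfolding smooth_on_def using Ck_on_compose[of S T f _ g] by blast

section \<open>A smooth bump function\<close>

text \<open>The extra factor \<open>t\<^sup>-\<^sup>m\<close> makes the family closed under differentiation up to linear
  combinations, which gives smoothness of all its members at once.\<close>

definition flat_exp :: "nat \<Rightarrow> real \<Rightarrow> real" where
  "flat_exp m t = (if t > 0 then exp (- inverse t) / t ^ m else 0)"

lemma flat_exp_has_derivative:
  "(flat_exp m has_derivative (\<lambda>v. v * (flat_exp (m + 2) t - m * flat_exp (m + 1) t))) (at t)"
proof -
  have "(flat_exp m has_real_derivative flat_exp (m + 2) t - m * flat_exp (m + 1) t) (at t)"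
  proof (cases t "0::real" rule: linorder_cases)
    case less
    have "((\<lambda>t. 0) has_real_derivative flat_exp (m + 2) t - m * flat_exp (m + 1) t) (at t)"
      using less by (simp add: flat_exp_def)
    then show ?thesis
      by (rule has_field_derivative_transform_within_open[where S = "{..<0}"])
        (use less in \<open>auto simp: flat_exp_def\<close>)
  next
    case greater
    have "((\<lambda>t. exp (- inverse t) / t ^ m) has_real_derivative
        flat_exp (m + 2) t - m * flat_exp (m + 1) t) (at t)"
      using greater
      by (cases m)
        (auto intro!: derivative_eq_intros simp: flat_exp_def field_simps power2_eq_square,
          metis One_nat_def power_eq_if)
    then show ?thesis
      by (rule has_field_derivative_transform_within_open[where S = "{0<..}"])
        (use greater in \<open>auto simp: flat_exp_def\<close>)
  next
    case equal
    \<comment> \<open>The difference quotient at \<open>0\<close> is \<open>t\<^sup>-\<^sup>m\<^sup>-\<^sup>1 e\<^bsup>-1/t\<^esup>\<close> on the right and \<open>0\<close> on the left.\<close>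
    have "((\<lambda>h. flat_exp m h / h) \<longlongrightarrow> 0) (at_right 0)"
    proof (rule Lim_transform_eventually)
      show "((\<lambda>h::real. exp (- inverse h) / h ^ m / h) \<longlongrightarrow> 0) (at_right 0)"
        by real_asymp
      show "\<forall>\<^sub>F h in at_right 0. exp (- inverse h) / h ^ m / h = flat_exp m h / h"
        by (auto simp: flat_exp_def eventually_at_filter)
    qed
    moreover have "((\<lambda>h. flat_exp m h / h) \<longlongrightarrow> 0) (at_left 0)"
      by (rule Lim_transform_eventually[OF tendsto_const])
        (auto simp: flat_exp_def eventually_at_filter)
    ultimately have "((\<lambda>h. flat_exp m h / h) \<longlongrightarrow> 0) (at 0)"
      by (simp add: filterlim_split_at)
    then show ?thesis
      using equal by (simp add: DERIV_def flat_exp_def)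
  qed
  then show ?thesis
    by (simp add: has_field_derivative_def mult.commute[of _ "_ - _"] fun_eq_iff)
qed

lemma Ck_on_flat_exp: "Ck_on k UNIV (flat_exp m)"
proof (induction k arbitrary: m)
  case 0
  show ?case
    using flat_exp_has_derivative has_derivative_continuous
    by (force simp: continuous_on_eq_continuous_at)
next
  case (Suc k)
  have "Ck_on k UNIV (\<lambda>t. v * (flat_exp (m + 2) t + (- real m) * flat_exp (m + 1) t))" for v
    by (intro Ck_on_bilinear[OF bounded_bilinear_mult] Ck_on_add Ck_on_const Suc.IH open_UNIV)
  then show ?case
    by (intro Ck_on_SucI[OF open_UNIV flat_exp_has_derivative]) simp
qed

lemma smooth_bump:
  fixes x0 :: "'a::euclidean_space"
  assumes "r > 0"
  obtains b :: "'a \<Rightarrow> real" where "smooth_on UNIV b" "b x0 = 1" "\<And>x. x \<notin> cball x0 r \<Longrightarrow> b x = 0"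
proof
  define b where "b x = exp (inverse (r\<^sup>2)) * flat_exp 0 (r\<^sup>2 - (x - x0) \<bullet> (x - x0))" for x
  have lin: "Ck_on k UNIV (\<lambda>x. x - x0)" for k
    using Ck_on_add[OF open_UNIV Ck_on_bounded_linear[OF bounded_linear_ident open_UNIV]
        Ck_on_const[OF open_UNIV, of _ "- x0"]] by simp
  have sq: "Ck_on k UNIV (\<lambda>x. (- 1) * ((x - x0) \<bullet> (x - x0)))" for k
    by (intro Ck_on_bilinear[OF bounded_bilinear_mult]
        Ck_on_bilinear[OF bounded_bilinear_inner] lin Ck_on_const open_UNIV)
  have "Ck_on k UNIV (\<lambda>x. r\<^sup>2 + (- 1) * ((x - x0) \<bullet> (x - x0)))" for k
    by (intro Ck_on_add sq Ck_on_const open_UNIV)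
  then have arg: "Ck_on k UNIV (\<lambda>x. r\<^sup>2 - (x - x0) \<bullet> (x - x0))" for k
    by simp
  have "Ck_on k UNIV b" for k
    unfolding b_def
    by (intro Ck_on_bilinear[OF bounded_bilinear_mult] Ck_on_const open_UNIV
        Ck_on_compose[OF open_UNIV open_UNIV _ arg Ck_on_flat_exp]) simp
  then show "smooth_on UNIV b"
    by (simp add: smooth_on_def)
  show "b x0 = 1"
    using assms by (simp add: b_def flat_exp_def mult_exp_exp)
  show "b x = 0" if "x \<notin> cball x0 r" for x
  proof -
    have "r < norm (x - x0)"
      using that by (simp add: dist_norm norm_minus_commute)
    then have "r\<^sup>2 < (norm (x - x0))\<^sup>2"
      using assms by (intro power_strict_mono) auto
    then show ?thesis
      by (simp add: b_def flat_exp_def dot_square_norm)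
  qed
qed

section \<open>Charts and vector fields\<close>

locale smooth_manifold =
  fixes A :: "('m::{t2_space, second_countable_topology}, real^'n) chart set"
  assumes atlas: "smooth_atlas A"
begin

lemma chart_at: "chart_at A p \<in> A" "p \<in> chart_dom (chart_at A p)"
proof -
  have "\<exists>c. c \<in> A \<and> p \<in> chart_dom c"
    using atlas unfolding smooth_atlas_def by blast
  then have "chart_at A p \<in> A \<and> p \<in> chart_dom (chart_at A p)"
    unfolding chart_at_def by (rule someI_ex)
  then show "chart_at A p \<in> A" "p \<in> chart_dom (chart_at A p)" by auto
qed

lemma open_chart_im: "c \<in> A \<Longrightarrow> open (chart_im c)"
  and open_chart_dom: "c \<in> A \<Longrightarrow> open (chart_dom c)"
  and chart_homeomorphism:
    "c \<in> A \<Longrightarrow> homeomorphism (chart_dom c) (chart_im c) (snd c) (chart_inv c)"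
  using atlas unfolding smooth_atlas_def by auto

lemma chart_inv_chart: "c \<in> A \<Longrightarrow> q \<in> chart_dom c \<Longrightarrow> chart_inv c (snd c q) = q"
  using chart_homeomorphism homeomorphism_apply1 by blast

lemma chart_chart_inv: "c \<in> A \<Longrightarrow> x \<in> chart_im c \<Longrightarrow> snd c (chart_inv c x) = x"
  using chart_homeomorphism homeomorphism_apply2 by blast

lemma chart_inv_in_dom: "c \<in> A \<Longrightarrow> x \<in> chart_im c \<Longrightarrow> chart_inv c x \<in> chart_dom c"
  using chart_inv_chart by fastforce

lemma open_chart_image: "c \<in> A \<Longrightarrow> open W \<Longrightarrow> open (snd c ` (chart_dom c \<inter> W))"
  by (metis chart_homeomorphism homeomorphism_imp_open_map open_chart_im openin_open_Int
      openin_open_trans)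

lemma open_chart_inv_image:
  assumes "c \<in> A" "open B" "B \<subseteq> chart_im c"
  shows "open (chart_inv c ` B)"
proof -
  have "openin (top_of_set (chart_dom c)) (chart_inv c ` B)"
    using homeomorphism_imp_open_map[OF homeomorphism_symD[OF chart_homeomorphism[OF assms(1)]]]
      open_openin_trans[OF open_chart_im[OF assms(1)] assms(2,3)] by blast
  then show ?thesis
    using open_chart_dom[OF assms(1)] openin_open_trans by blast
qed

lemma smooth_transition:
  "c \<in> A \<Longrightarrow> d \<in> A \<Longrightarrow>
    smooth_on (snd c ` (chart_dom c \<inter> chart_dom d)) (snd d \<circ> chart_inv c)"
  using atlas unfolding smooth_atlas_def by blast

lemma transition_has_derivative:
  assumes "c \<in> A" "d \<in> A" "q \<in> chart_dom c" "q \<in> chart_dom d"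
  shows "(snd d \<circ> chart_inv c has_derivative
    frechet_derivative (snd d \<circ> chart_inv c) (at (snd c q))) (at (snd c q))"
  using assms
  by (intro smooth_on_derivative[OF smooth_transition] open_chart_image open_chart_dom) auto

text \<open>This is the chain rule for \<open>f \<circ> c\<^sup>-\<^sup>1 = (f \<circ> d\<^sup>-\<^sup>1) \<circ> (d \<circ> c\<^sup>-\<^sup>1)\<close>, valid near the point. It is needed
  because \<open>mdiff\<close> at \<open>q\<close> uses the chart selected at \<open>q\<close>, while statements about a neighbourhood of a
  point must be made in one fixed chart.\<close>

lemma change_of_chart:
  assumes "c \<in> A" "d \<in> A" "q \<in> chart_dom c" "q \<in> chart_dom d"
    and "(f \<circ> chart_inv d has_derivative F) (at (snd d q))"
  shows "(f \<circ> chart_inv c has_derivative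
    (\<lambda>v. F (frechet_derivative (snd d \<circ> chart_inv c) (at (snd c q)) v))) (at (snd c q))"
proof -
  let ?U = "snd c ` (chart_dom c \<inter> chart_dom d)"
  have "snd d q = (snd d \<circ> chart_inv c) (snd c q)"
    by (simp add: assms chart_inv_chart)
  from has_derivative_compose[OF transition_has_derivative[OF assms(1-4)] assms(5)[unfolded this]]
  have "((\<lambda>x. (f \<circ> chart_inv d) ((snd d \<circ> chart_inv c) x)) has_derivative
    (\<lambda>v. F (frechet_derivative (snd d \<circ> chart_inv c) (at (snd c q)) v))) (at (snd c q))" .
  moreover have "open ?U"
    using assms by (intro open_chart_image open_chart_dom)
  moreover have "snd c q \<in> ?U"
    using assms by blast
  moreover have "(f \<circ> chart_inv d) ((snd d \<circ> chart_inv c) x) = (f \<circ> chart_inv c) x" if "x \<in> ?U" for x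
    using that by (auto simp: assms chart_inv_chart)
  ultimately show ?thesis
    by (rule has_derivative_transform_within_open)
qed

lemma transition_chain:
  assumes "c \<in> A" "d \<in> A" "e \<in> A" "q \<in> chart_dom c" "q \<in> chart_dom d" "q \<in> chart_dom e"
  shows "frechet_derivative (snd e \<circ> chart_inv d) (at (snd d q))
      (frechet_derivative (snd d \<circ> chart_inv c) (at (snd c q)) v)
    = frechet_derivative (snd e \<circ> chart_inv c) (at (snd c q)) v"
  using frechet_derivative_at[OF change_of_chart[OF assms(1,2,4,5)
        transition_has_derivative[OF assms(2,3,5,6)]]]
  by metis

lemma transition_self:
  assumes "c \<in> A" "q \<in> chart_dom c"
  shows "frechet_derivative (snd c \<circ> chart_inv c) (at (snd c q)) v = v"
proof -
  have "(snd c \<circ> chart_inv c has_derivative (\<lambda>v. v)) (at (snd c q))"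
    by (rule has_derivative_transform_within_open[OF has_derivative_ident open_chart_im[OF assms(1)]])
      (auto simp: assms chart_inv_chart[OF assms(1)])
  then show ?thesis
    using frechet_derivative_at by metis
qed

lemma linear_mdiff_chart:
  assumes "c \<in> A" "q \<in> chart_dom c"
  shows "linear (mdiff A (snd c) q)"
  using has_derivative_linear[OF transition_has_derivative[OF chart_at(1) assms(1) chart_at(2) assms(2)]]
  by (simp add: mdiff_def[abs_def])

lemma vector_field_add:
  assumes "vector_field A X" "vector_field A Y"
  shows "vector_field A (\<lambda>p. X p + Y p)"
  unfolding vector_field_def
proof
  fix c assume c: "c \<in> A"
  have "smooth_on (chart_im c) (\<lambda>x. local_repr A c X x + local_repr A c Y x)"
    using assms c unfolding vector_field_def by (intro smooth_on_add open_chart_im) auto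
  moreover have "local_repr A c X x + local_repr A c Y x = local_repr A c (\<lambda>p. X p + Y p) x"
    if "x \<in> chart_im c" for x
    using linear_add[OF linear_mdiff_chart[OF c chart_inv_in_dom[OF c that]]]
    by (simp add: local_repr_def)
  ultimately show "smooth_on (chart_im c) (local_repr A c (\<lambda>p. X p + Y p))"
    by (rule smooth_on_cong[OF open_chart_im[OF c], rotated])
qed

lemma vector_field_scaleR:
  assumes "vector_field A X"
  shows "vector_field A (\<lambda>p. a *\<^sub>R X p)"
  unfolding vector_field_def
proof
  fix c assume c: "c \<in> A"
  have "smooth_on (chart_im c) (\<lambda>x. a *\<^sub>R local_repr A c X x)"
    using assms c unfolding vector_field_def
    by (intro smooth_on_scaleR smooth_on_const open_chart_im) auto
  moreover have "a *\<^sub>R local_repr A c X x = local_repr A c (\<lambda>p. a *\<^sub>R X p) x"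
    if "x \<in> chart_im c" for x
    using linear_scale[OF linear_mdiff_chart[OF c chart_inv_in_dom[OF c that]]]
    by (simp add: local_repr_def)
  ultimately show "smooth_on (chart_im c) (local_repr A c (\<lambda>p. a *\<^sub>R X p))"
    by (rule smooth_on_cong[OF open_chart_im[OF c], rotated])
qed

lemma smooth_fun_const: "smooth_fun A (\<lambda>p. a)"
  by (simp add: smooth_fun_def o_def smooth_on_const open_chart_im)

lemma deriv_along_const: "deriv_along A X (\<lambda>p. a) p = 0"
  by (simp add: deriv_along_def mdiff_def o_def)

text \<open>Let \<open>c\<close> be the chart selected at \<open>p\<close> and \<open>b\<close> a bump function at \<open>c p\<close> supported in a closed ball
  inside the image of \<open>c\<close>. The field has components \<open>b v\<close> in the chart \<open>c\<close> and is zero outside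
  its domain; its components are then transformed to the chart selected at each point. In any
  chart \<open>d\<close> it is smooth near points of the domain of \<open>c\<close> by smoothness of transition maps. The
  preimage \<open>K\<close> of the ball is compact, hence closed as the manifold is Hausdorff, so that all other
  points have the neighbourhood \<open>- K\<close>, where the field vanishes.\<close>

lemma vector_field_extension:
  obtains X where "vector_field A X" "X p = v"
proof -
  define c where "c = chart_at A p"
  have c: "c \<in> A" "p \<in> chart_dom c"
    by (auto simp: c_def chart_at)
  obtain r where r: "r > 0" "cball (snd c p) r \<subseteq> chart_im c"
    using open_chart_im[OF c(1)] c(2) open_contains_cball by blast
  obtain b :: "real^'n \<Rightarrow> real" where b: "smooth_on UNIV b" "b (snd c p) = 1"
    "\<And>x. x \<notin> cball (snd c p) r \<Longrightarrow> b x = 0"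
    using smooth_bump[OF r(1)] by metis
  define T where "T d y = frechet_derivative (snd d \<circ> chart_inv c) (at y) v"
    for d :: "('m, real^'n) chart" and y
  define X where "X q = (if q \<in> chart_dom c then b (snd c q) *\<^sub>R T (chart_at A q) (snd c q) else 0)" for q
  define K where "K = chart_inv c ` cball (snd c p) r"
  have "compact K"
    unfolding K_def using r(2) homeomorphism_cont2[OF chart_homeomorphism[OF c(1)]]
    by (intro compact_continuous_image continuous_on_subset[OF _ r(2)] compact_cball)
  then have "open (- K)"
    by (simp add: compact_imp_closed open_Compl)
  have K_dom: "K \<subseteq> chart_dom c"
    unfolding K_def using r(2) chart_inv_in_dom[OF c(1)] by blast
  have X_zero: "X q = 0" if "q \<notin> K" for q
  proof (cases "q \<in> chart_dom c")
    case True
    then have "snd c q \<notin> cball (snd c p) r"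
      using that chart_inv_chart[OF c(1) True] unfolding K_def by (metis imageI)
    then show ?thesis by (simp add: X_def b(3))
  qed (simp add: X_def)
  have "smooth_on (chart_im d) (local_repr A d X)" if d: "d \<in> A" for d
  proof (rule smooth_on_local[OF _ open_chart_im[OF d]])
    fix x assume "x \<in> chart_im d"
    then obtain q where q: "q \<in> chart_dom d" "x = snd d q" by blast
    show "\<exists>U. open U \<and> x \<in> U \<and> smooth_on U (local_repr A d X)"
    proof (cases "q \<in> chart_dom c")
      case True
      let ?U = "snd d ` (chart_dom d \<inter> chart_dom c)" and ?W = "snd c ` (chart_dom c \<inter> chart_dom d)"
      have U: "open ?U" "open ?W"
        using c d by (auto intro!: open_chart_image open_chart_dom)
      have "smooth_on ?W (\<lambda>z. b z *\<^sub>R T d z)"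
        unfolding T_def using U smooth_on_subset[OF b(1)] smooth_transition[OF c(1) d]
        by (intro smooth_on_scaleR smooth_on_frechet_derivative) auto
      moreover have "(snd c \<circ> chart_inv d) ` ?U \<subseteq> ?W"
        using chart_inv_chart[OF d] by auto
      ultimately have smooth:
        "smooth_on ?U (\<lambda>y. b ((snd c \<circ> chart_inv d) y) *\<^sub>R T d ((snd c \<circ> chart_inv d) y))"
        using smooth_on_compose[OF U _ smooth_transition[OF d c(1)]] by blast
      have "b ((snd c \<circ> chart_inv d) y) *\<^sub>R T d ((snd c \<circ> chart_inv d) y) = local_repr A d X y"
        if "y \<in> ?U" for y
      proof -
        obtain s where s: "s \<in> chart_dom d" "s \<in> chart_dom c" "y = snd d s"
          using \<open>y \<in> ?U\<close> by blast
        have "mdiff A (snd d) s (T (chart_at A s) (snd c s)) = T d (snd c s)"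
          unfolding mdiff_def T_def using c d s by (intro transition_chain chart_at)
        then show ?thesis
          using s chart_inv_chart[OF d s(1)] linear_scale[OF linear_mdiff_chart[OF d s(1)]]
          by (simp add: local_repr_def X_def)
      qed
      then have "smooth_on ?U (local_repr A d X)"
        using smooth_on_cong[OF U(1) _ smooth] by blast
      then show ?thesis
        using U(1) q True by blast
    next
      case False
      let ?U = "snd d ` (chart_dom d \<inter> - K)"
      have U: "open ?U"
        using d \<open>open (- K)\<close> by (rule open_chart_image)
      have "0 = local_repr A d X y" if "y \<in> ?U" for y
      proof -
        obtain s where s: "s \<in> chart_dom d" "s \<notin> K" "y = snd d s"
          using \<open>y \<in> ?U\<close> by blast
        then show ?thesis
          using X_zero chart_inv_chart[OF d s(1)] linear_0[OF linear_mdiff_chart[OF d s(1)]]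
          by (simp add: local_repr_def)
      qed
      then have "smooth_on ?U (local_repr A d X)"
        using smooth_on_cong[OF U _ smooth_on_const[OF U]] by blast
      then show ?thesis
        using U q False K_dom by blast
    qed
  qed
  then have "vector_field A X"
    by (simp add: vector_field_def)
  moreover have "X p = v"
    using c b(2) transition_self[OF c] by (simp add: X_def T_def flip: c_def)
  ultimately show ?thesis
    using that by blast
qed

text \<open>By \<open>vector_field_extension\<close> the differential of \<open>k\<close> is zero in the selected charts, thus in all
  charts by \<open>change_of_chart\<close>. So \<open>k\<close> is constant on preimages of coordinate balls, that is,
  locally constant.\<close>

lemma zero_differential_imp_constant:
  assumes "connected (UNIV :: 'm set)" "smooth_fun A k"
    and zero: "\<And>X p. vector_field A X \<Longrightarrow> deriv_along A X k p = 0"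
  shows "\<exists>a. \<forall>p. k p = a"
proof -
  have der: "(k \<circ> chart_inv c has_derivative (\<lambda>v. 0)) (at x)" if c: "c \<in> A" and x: "x \<in> chart_im c" for c x
  proof -
    obtain q where q: "q \<in> chart_dom c" "x = snd c q"
      using x by blast
    define d where "d = chart_at A q"
    have d: "d \<in> A" "q \<in> chart_dom d"
      by (auto simp: d_def chart_at)
    have "smooth_on (chart_im d) (k \<circ> chart_inv d)"
      using assms(2) d(1) by (simp add: smooth_fun_def)
    then have "(k \<circ> chart_inv d has_derivative frechet_derivative (k \<circ> chart_inv d) (at (snd d q)))
        (at (snd d q))"
      using d by (intro smooth_on_derivative[OF _ open_chart_im]) auto
    moreover have "frechet_derivative (k \<circ> chart_inv d) (at (snd d q)) = (\<lambda>v. 0)"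
    proof
      fix v
      obtain X where "vector_field A X" "X q = v"
        using vector_field_extension .
      with zero[of X q] show "frechet_derivative (k \<circ> chart_inv d) (at (snd d q)) v = 0"
        by (simp add: deriv_along_def mdiff_def d_def)
    qed
    ultimately have "(k \<circ> chart_inv d has_derivative (\<lambda>v. 0)) (at (snd d q))"
      by simp
    then show ?thesis
      using change_of_chart[OF c d(1) q(1) d(2)] q(2) by blast
  qed
  have "\<forall>\<^sub>F q in at p. k p = k q" for p
  proof -
    define c where "c = chart_at A p"
    have c: "c \<in> A" "p \<in> chart_dom c"
      by (auto simp: c_def chart_at)
    obtain r where r: "r > 0" "ball (snd c p) r \<subseteq> chart_im c"
      using open_chart_im[OF c(1)] c(2) open_contains_ball by blast
    obtain a where a: "\<And>x. x \<in> ball (snd c p) r \<Longrightarrow> (k \<circ> chart_inv c) x = a"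
      using has_derivative_zero_constant[of "ball (snd c p) r" "k \<circ> chart_inv c"] der[OF c(1)] r(2)
      by (meson convex_ball has_derivative_at_withinI subsetD)
    let ?W = "chart_inv c ` ball (snd c p) r"
    have "open ?W"
      using c(1) r(2) by (intro open_chart_inv_image) auto
    moreover have "p \<in> ?W"
      using chart_inv_chart[OF c] r(1) by (metis centre_in_ball imageI)
    moreover have "k q = a" if "q \<in> ?W" for q
      using that a by auto
    ultimately show ?thesis
      unfolding eventually_at_topological by metis
  qed
  then have "k p = k q" for p q
    using connected_local_const[OF assms(1)] by blast
  then show ?thesis by blast
qed

end

section \<open>Para Sasakian manifolds and solitons\<close>

locale para_sasakian_manifold = smooth_manifold A
  for A :: "('m::{t2_space, second_countable_topology}, real^'n) chart set" +
  fixes nabla :: "('m \<Rightarrow> real^'n) \<Rightarrow> ('m \<Rightarrow> real^'n) \<Rightarrow> ('m \<Rightarrow> real^'n)"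
    and \<phi> :: "'m \<Rightarrow> real^'n \<Rightarrow> real^'n"
    and \<xi> :: "'m \<Rightarrow> real^'n"
    and \<eta> :: "'m \<Rightarrow> real^'n \<Rightarrow> real"
    and g :: "'m \<Rightarrow> real^'n \<Rightarrow> real^'n \<Rightarrow> real"
    and \<epsilon> :: real
  assumes levi_civita: "levi_civita_connection A g nabla"
    and para_sasakian: "eps_para_sasakian A nabla \<phi> \<xi> \<eta> g \<epsilon>"
begin

lemma vector_field_xi: "vector_field A \<xi>"
  and vector_field_phi: "vector_field A X \<Longrightarrow> vector_field A (\<lambda>p. \<phi> p (X p))"
  and linear_phi: "linear (\<phi> p)"
  and linear_eta: "linear (\<eta> p)"
  and bilinear_metric: "bilinear (g p)"
  and metric_sym: "g p v w = g p w v"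
  and eps_square: "\<epsilon> * \<epsilon> = 1"
  and phi_phi: "\<phi> p (\<phi> p v) = v - \<eta> p v *\<^sub>R \<xi> p"
  and eta_xi: "\<eta> p (\<xi> p) = 1"
  and phi_xi: "\<phi> p (\<xi> p) = 0"
  and eta_phi: "\<eta> p (\<phi> p v) = 0"
  and metric_phi_phi: "g p (\<phi> p v) (\<phi> p w) = g p v w - \<epsilon> * \<eta> p v * \<eta> p w"
  using para_sasakian
  unfolding eps_para_sasakian_def eps_almost_paracontact_metric_def pseudo_riemannian_metric_def
    endo_field_def one_form_def
  by auto

lemmas metric_simps =
  bilinear_ladd[OF bilinear_metric] bilinear_radd[OF bilinear_metric]
  bilinear_lmul[OF bilinear_metric] bilinear_rmul[OF bilinear_metric]
  bilinear_lsub[OF bilinear_metric] bilinear_rsub[OF bilinear_metric]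
  bilinear_lzero[OF bilinear_metric] bilinear_rzero[OF bilinear_metric]

lemma nabla_phi:
  "vector_field A X \<Longrightarrow> vector_field A Y \<Longrightarrow>
    nabla X (\<lambda>q. \<phi> q (Y q)) p = \<phi> p (nabla X Y p)
      - g p (\<phi> p (X p)) (\<phi> p (Y p)) *\<^sub>R \<xi> p - (\<epsilon> * \<eta> p (Y p)) *\<^sub>R \<phi> p (\<phi> p (X p))"
  using para_sasakian unfolding eps_para_sasakian_def by (simp add: algebra_simps)

lemma vector_field_nabla:
    "vector_field A X \<Longrightarrow> vector_field A Y \<Longrightarrow> vector_field A (nabla X Y)"
  and nabla_scale_right: "smooth_fun A f \<Longrightarrow> vector_field A X \<Longrightarrow> vector_field A Y \<Longrightarrow>
    nabla X (\<lambda>p. f p *\<^sub>R Y p) p = deriv_along A X f p *\<^sub>R Y p + f p *\<^sub>R nabla X Y p"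
  and lie_bracket_nabla: "vector_field A X \<Longrightarrow> vector_field A Y \<Longrightarrow>
    lie_bracket A X Y p = nabla X Y p - nabla Y X p"
  and metric_compatible: "vector_field A X \<Longrightarrow> vector_field A Y \<Longrightarrow> vector_field A Z \<Longrightarrow>
    deriv_along A X (\<lambda>q. g q (Y q) (Z q)) p = g p (nabla X Y p) (Z p) + g p (Y p) (nabla X Z p)"
  using levi_civita unfolding levi_civita_connection_def affine_connection_def by auto

lemma vector_field_lie_bracket:
  assumes "vector_field A X" "vector_field A Y"
  shows "vector_field A (lie_bracket A X Y)"
proof -
  have "lie_bracket A X Y = (\<lambda>p. nabla X Y p + (- 1) *\<^sub>R nabla Y X p)"
    using lie_bracket_nabla[OF assms] by auto
  then show ?thesis
    using assms by (simp only: vector_field_add vector_field_scaleR vector_field_nabla)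
qed

text \<open>The left-hand side of \<open>g(\<phi> v, \<phi> \<xi>) = g(v, \<xi>) - \<epsilon> \<eta>(v) \<eta>(\<xi>)\<close> is zero because \<open>\<phi> \<xi> = 0\<close>.\<close>

lemma metric_xi: "g p v (\<xi> p) = \<epsilon> * \<eta> p v"
  using metric_phi_phi[of p v "\<xi> p"] by (simp add: phi_xi eta_xi metric_simps)

text \<open>Apply the compatibility of \<open>g\<close> with \<open>\<phi>\<close> to the arguments \<open>\<phi> v\<close> and \<open>w\<close>, where \<open>\<eta>(\<phi> v) = 0\<close> and
  \<open>\<phi>\<^sup>2 v\<close> differs from \<open>v\<close> by a multiple of \<open>\<xi>\<close>, which is orthogonal to \<open>\<phi> w\<close>.\<close>

lemma phi_self_adjoint: "g p v (\<phi> p w) = g p (\<phi> p v) w"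
  using metric_phi_phi[of p "\<phi> p v" w] metric_xi[of p "\<phi> p w"]
  by (simp add: phi_phi eta_phi metric_simps metric_sym[of p "\<xi> p"])

text \<open>Differentiating \<open>\<phi> \<xi> = 0\<close> determines \<open>\<phi>(\<nabla>\<^sub>X \<xi>)\<close>, hence, after applying \<open>\<phi>\<close> again, \<open>\<nabla>\<^sub>X \<xi>\<close> up to a
  multiple of \<open>\<xi>\<close>. Differentiating \<open>g(\<xi>, \<xi>) = \<epsilon>\<close> shows that this multiple is zero.\<close>

lemma nabla_xi:
  assumes X: "vector_field A X"
  shows "nabla X \<xi> p = \<epsilon> *\<^sub>R \<phi> p (X p)"
proof -
  let ?N = "nabla X \<xi> p"
  have "nabla X (\<lambda>q. 0) p = 0"
    using nabla_scale_right[OF smooth_fun_const X vector_field_xi, of 0] by (simp add: deriv_along_const)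
  then have "\<phi> p ?N = \<epsilon> *\<^sub>R \<phi> p (\<phi> p (X p))"
    using nabla_phi[OF X vector_field_xi, of p] by (simp add: phi_xi eta_xi metric_simps)
  then have "\<phi> p (\<phi> p ?N) = \<epsilon> *\<^sub>R \<phi> p (\<phi> p (\<phi> p (X p)))"
    by (simp add: linear_scale[OF linear_phi])
  then have "?N - \<eta> p ?N *\<^sub>R \<xi> p = \<epsilon> *\<^sub>R \<phi> p (X p)"
    by (simp add: phi_phi[of p "\<phi> p (X p)"] phi_phi[of p ?N] eta_phi)
  moreover have "\<eta> p ?N = 0"
  proof -
    have "(\<lambda>q. g q (\<xi> q) (\<xi> q)) = (\<lambda>q. \<epsilon>)"
      by (simp add: metric_xi eta_xi)
    then have "2 * (\<epsilon> * \<eta> p ?N) = 0"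
      using metric_compatible[OF X vector_field_xi vector_field_xi, of p]
      by (simp add: deriv_along_const metric_sym[of p "\<xi> p"] metric_xi)
    then show ?thesis
      using eps_square by auto
  qed
  ultimately show ?thesis by simp
qed

text \<open>As \<open>\<nabla>\<^sub>Y \<xi> = \<epsilon> \<phi> Y\<close> and \<open>\<nabla>\<close> is torsion-free, \<open>R(X, Y)\<xi> = \<epsilon> ((\<nabla>\<^sub>X \<phi>) Y - (\<nabla>\<^sub>Y \<phi>) X)\<close>. The multiples of
  \<open>\<xi>\<close> in the para Sasakian identity are symmetric in \<open>X\<close> and \<open>Y\<close> and cancel.\<close>

lemma curvature_xi:
  assumes X: "vector_field A X" and Y: "vector_field A Y"
  shows "curvature A nabla X Y \<xi> p = \<eta> p (X p) *\<^sub>R Y p - \<eta> p (Y p) *\<^sub>R X p"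
proof -
  have second: "nabla X (nabla Y \<xi>) p = \<epsilon> *\<^sub>R \<phi> p (nabla X Y p)
      - (\<epsilon> * g p (\<phi> p (X p)) (\<phi> p (Y p))) *\<^sub>R \<xi> p - \<eta> p (Y p) *\<^sub>R \<phi> p (\<phi> p (X p))"
    if X: "vector_field A X" and Y: "vector_field A Y" for X Y
  proof -
    have "nabla Y \<xi> = (\<lambda>q. \<epsilon> *\<^sub>R \<phi> q (Y q))"
      using nabla_xi[OF Y] by auto
    then have "nabla X (nabla Y \<xi>) p = \<epsilon> *\<^sub>R nabla X (\<lambda>q. \<phi> q (Y q)) p"
      using nabla_scale_right[OF smooth_fun_const X vector_field_phi[OF Y]]
      by (simp add: deriv_along_const)
    also have "\<dots> = \<epsilon> *\<^sub>R \<phi> p (nabla X Y p)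
        - (\<epsilon> * g p (\<phi> p (X p)) (\<phi> p (Y p))) *\<^sub>R \<xi> p
        - (\<epsilon> * \<epsilon> * \<eta> p (Y p)) *\<^sub>R \<phi> p (\<phi> p (X p))"
      by (simp add: nabla_phi[OF X Y] scaleR_diff_right mult.assoc)
    finally show ?thesis by (simp add: eps_square)
  qed
  have "nabla (lie_bracket A X Y) \<xi> p = \<epsilon> *\<^sub>R \<phi> p (nabla X Y p) - \<epsilon> *\<^sub>R \<phi> p (nabla Y X p)"
    using nabla_xi[OF vector_field_lie_bracket[OF X Y]]
    by (simp add: lie_bracket_nabla[OF X Y] linear_diff[OF linear_phi] scaleR_diff_right)
  then show ?thesis
    unfolding curvature_def
    by (simp add: second[OF X Y] second[OF Y X] metric_sym[of p "\<phi> p (Y p)"] phi_phi algebra_simps)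
qed

text \<open>The endomorphism \<open>v \<mapsto> \<eta>(v) Y - \<eta>(Y) v\<close> has trace \<open>\<eta>(Y) - n \<eta>(Y)\<close>.\<close>

lemma ricci_xi:
  assumes Y: "vector_field A Y"
  shows "ricci A nabla Y \<xi> p = (1 - real CARD('n)) * \<eta> p (Y p)"
proof -
  define L where "L v = \<eta> p v *\<^sub>R Y p - \<eta> p (Y p) *\<^sub>R v" for v
  have "linear L"
    unfolding L_def
    by (intro linearI) (simp_all add: linear_add[OF linear_eta] linear_scale[OF linear_eta] algebra_simps)
  have "curvature_endo A nabla Y \<xi> p = L"
    unfolding curvature_endo_def
  proof (rule the_equality)
    show "linear L \<and> (\<forall>X. vector_field A X \<longrightarrow> L (X p) = curvature A nabla X Y \<xi> p)"
      using \<open>linear L\<close> curvature_xi[OF _ Y] by (simp add: L_def)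
  next
    fix M assume M: "linear M \<and> (\<forall>X. vector_field A X \<longrightarrow> M (X p) = curvature A nabla X Y \<xi> p)"
    show "M = L"
    proof
      fix v
      obtain X where "vector_field A X" "X p = v"
        using vector_field_extension .
      then show "M v = L v"
        using M curvature_xi[OF _ Y] by (auto simp: L_def)
    qed
  qed
  then have "ricci A nabla Y \<xi> p = (\<Sum>i\<in>UNIV. L (axis i 1) $ i)"
    by (simp add: ricci_def trace_def matrix_def)
  also have "\<dots> = (\<Sum>i\<in>UNIV. Y p $ i * \<eta> p (axis i 1)) - (\<Sum>i\<in>(UNIV::'n set). \<eta> p (Y p))"
    by (simp add: L_def axis_def sum_subtractf mult.commute)
  also have "(\<Sum>i\<in>UNIV. Y p $ i * \<eta> p (axis i 1)) = \<eta> p (\<Sum>i\<in>UNIV. Y p $ i *\<^sub>R axis i 1)"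
    by (simp add: linear_sum[OF linear_eta] linear_scale[OF linear_eta])
  also have "(\<Sum>i\<in>UNIV. Y p $ i *\<^sub>R axis i 1) = Y p"
    using basis_expansion[of "Y p"] by (simp add: scalar_mult_eq_scaleR)
  finally show ?thesis
    by (simp add: algebra_simps)
qed

text \<open>For the Levi-Civita connection \<open>(L\<^sub>V g)(X, Y) = g(\<nabla>\<^sub>X V, Y) + g(X, \<nabla>\<^sub>Y V)\<close>, and
  \<open>\<nabla>\<^sub>X (k \<xi>) = (X k) \<xi> + \<epsilon> k \<phi> X\<close>.\<close>

lemma lie_deriv_metric_collinear:
  assumes "smooth_fun A k" and V: "vector_field A V" "\<And>p. V p = k p *\<^sub>R \<xi> p"
    and X: "vector_field A X" and Y: "vector_field A Y"
  shows "lie_deriv_metric A V g X Y p =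
    \<epsilon> * (deriv_along A X k p * \<eta> p (Y p) + deriv_along A Y k p * \<eta> p (X p))
      + 2 * \<epsilon> * k p * g p (\<phi> p (X p)) (Y p)"
proof -
  have nabla_V: "nabla Z V p = deriv_along A Z k p *\<^sub>R \<xi> p + (\<epsilon> * k p) *\<^sub>R \<phi> p (Z p)"
    if Z: "vector_field A Z" for Z
  proof -
    have "V = (\<lambda>p. k p *\<^sub>R \<xi> p)"
      using V(2) by auto
    then show ?thesis
      using nabla_scale_right[OF assms(1) Z vector_field_xi] nabla_xi[OF Z] by (simp add: mult.commute)
  qed
  have "lie_deriv_metric A V g X Y p = g p (nabla X V p) (Y p) + g p (X p) (nabla Y V p)"
    unfolding lie_deriv_metric_def
    by (simp add: metric_compatible[OF V(1) X Y] lie_bracket_nabla[OF V(1) X]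
        lie_bracket_nabla[OF V(1) Y] metric_simps)
  also have "\<dots> = \<epsilon> * (deriv_along A X k p * \<eta> p (Y p) + deriv_along A Y k p * \<eta> p (X p))
      + 2 * \<epsilon> * k p * g p (\<phi> p (X p)) (Y p)"
    by (simp add: nabla_V[OF X] nabla_V[OF Y] metric_simps metric_sym[of p "\<xi> p"] metric_xi
        phi_self_adjoint algebra_simps)
  finally show ?thesis .
qed

text \<open>This is the soliton equation with second argument \<open>\<xi>\<close>: the hypothesis on the constants cancels
  the terms that do not involve \<open>k\<close>, leaving \<open>X k + (\<xi> k) \<eta>(X) = 0\<close>. For \<open>X = \<xi>\<close> this reads
  \<open>2 (\<xi> k) = 0\<close>, which removes the second summand for all other \<open>X\<close>.\<close>

lemma deriv_along_potential_eq_0: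
  assumes soliton: "eta_ricci_soliton A nabla \<eta> g V lam mu"
    and k: "smooth_fun A k" and V: "\<And>p. V p = k p *\<^sub>R \<xi> p"
    and const: "\<epsilon> * (real CARD('n) - 1) = lam + \<epsilon> * mu"
    and X: "vector_field A X"
  shows "deriv_along A X k p = 0"
proof -
  have V': "vector_field A V"
    using soliton by (simp add: eta_ricci_soliton_def)
  have dim: "real CARD('n) - 1 = \<epsilon> * lam + mu"
    using arg_cong[OF const, of "\<lambda>x. \<epsilon> * x"] by (simp add: distrib_left eps_square flip: mult.assoc)
  have eq: "deriv_along A X k p + deriv_along A \<xi> k p * \<eta> p (X p) = 0" if X: "vector_field A X" for X
  proof -
    have "1 / 2 * lie_deriv_metric A V g X \<xi> p + ricci A nabla X \<xi> p
        + lam * g p (X p) (\<xi> p) + mu * \<eta> p (X p) * \<eta> p (\<xi> p) = 0"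
      using soliton X vector_field_xi unfolding eta_ricci_soliton_def by blast
    then have "\<epsilon> * (deriv_along A X k p + deriv_along A \<xi> k p * \<eta> p (X p)) / 2
        + ((\<epsilon> * lam + mu) - (real CARD('n) - 1)) * \<eta> p (X p) = 0"
      using lie_deriv_metric_collinear[OF k V' V X vector_field_xi]
      by (simp add: ricci_xi[OF X] metric_xi eta_xi eta_phi algebra_simps add_divide_distrib)
    then show ?thesis
      using dim eps_square by auto
  qed
  have "deriv_along A \<xi> k p = 0"
    using eq[OF vector_field_xi] by (simp add: eta_xi)
  then show ?thesis
    using eq[OF X] by simp
qed

end

theorem theorem4p1:
  fixes A :: "('m::{t2_space, second_countable_topology}, real^'n) chart set"
    and nabla :: "('m \<Rightarrow> real^'n) \<Rightarrow> ('m \<Rightarrow> real^'n) \<Rightarrow> ('m \<Rightarrow> real^'n)"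
    and \<phi> :: "'m \<Rightarrow> real^'n \<Rightarrow> real^'n"
    and \<xi> :: "'m \<Rightarrow> real^'n"
    and \<eta> :: "'m \<Rightarrow> real^'n \<Rightarrow> real"
    and g :: "'m \<Rightarrow> real^'n \<Rightarrow> real^'n \<Rightarrow> real"
    and \<epsilon> lam mu :: real
    and V :: "'m \<Rightarrow> real^'n"
    and k :: "'m \<Rightarrow> real"
  assumes "smooth_atlas A"
    and "connected (UNIV :: 'm set)"
    and "levi_civita_connection A g nabla"
    and "eps_para_sasakian A nabla \<phi> \<xi> \<eta> g \<epsilon>"
    and "eta_ricci_soliton A nabla \<eta> g V lam mu"
    and "smooth_fun A k"
    and "\<forall>p. V p = k p *\<^sub>R \<xi> p"
    and "\<epsilon> * (real CARD('n) - 1) = lam + \<epsilon> * mu"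
  shows "(\<exists>c. \<forall>p. V p = c *\<^sub>R \<xi> p) \<and> einstein_like A nabla \<phi> \<eta> g"
proof -
  interpret para_sasakian_manifold A nabla \<phi> \<xi> \<eta> g \<epsilon>
    using assms(1,3,4) by unfold_locales
  have V: "V p = k p *\<^sub>R \<xi> p" for p
    using assms(7) by blast
  have dk: "deriv_along A X k p = 0" if "vector_field A X" for X p
    using deriv_along_potential_eq_0[OF assms(5,6) V assms(8) that] .
  then obtain c where c: "\<And>p. k p = c"
    using zero_differential_imp_constant[OF assms(2,6)] by blast
  have "ricci A nabla X Y p = (- lam) * g p (X p) (Y p)
      + (- (\<epsilon> * c)) * g p (\<phi> p (X p)) (Y p) + (- mu) * \<eta> p (X p) * \<eta> p (Y p)"
    if X: "vector_field A X" and Y: "vector_field A Y" for X Y p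
  proof -
    have V': "vector_field A V"
      and "1 / 2 * lie_deriv_metric A V g X Y p + ricci A nabla X Y p
        + lam * g p (X p) (Y p) + mu * \<eta> p (X p) * \<eta> p (Y p) = 0"
      using assms(5) X Y unfolding eta_ricci_soliton_def by auto
    then show ?thesis
      using lie_deriv_metric_collinear[OF assms(6) V' V X Y, of p, unfolded c]
      by (simp add: deriv_along_const)
  qed
  then have "einstein_like A nabla \<phi> \<eta> g"
    unfolding einstein_like_def by blast
  moreover have "\<forall>p. V p = c *\<^sub>R \<xi> p"
    using V c by simp
  ultimately show ?thesis by blast
qed

end
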